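(* Let $F(x,t)=\gamma(x)+t\xi(x)$ be a $k$-th pseudo cylindrical developable surface with associated functions $p,q,\delta$, signed area density $\lambda$ and null vector field $\eta$ as in the context. Suppose $q(x)=\tilde q(x)x^{Q}$ with $\tilde q$ real analytic and $Q\ge k$. Let $t(x)=-\dfrac{\tilde q(x)}{\|\tilde\xi(x)\|}x^{Q-k}$ be the analytic extension of $-q(x)/\delta(x)$, let $p_0=(0,t(0))$, and let $$\sigma(x)=\delta(x)\left(p(x)-\left(\frac{q(x)}{\delta(x)}\right)'\right)=\delta(x)\bigl(p(x)+t'(x)\bigr).$$ Then for every integer $n\ge1$: (1) $\eta\lambda(p_0)\neq0$ if and only if $\sigma(0)\neq0$; (2) $\eta\lambda(p_0)=\cdots=\eta^{(n)}\lambda(p_0)=0$ and $\eta^{(n+1)}\lambda(p_0)\neq0$ if and only if $\sigma(0)=\cdots=\sigma^{(n-1)}(0)=0$ and $\sigma^{(n)}(0)\neq0$.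
   Context: Let $I\subset\mathbb{R}$ be an open interval containing $0$ (all statements are local at $x=0$, so $I$ may be shrunk), and let $\gamma:I\to\mathbb{R}^3$ with $\gamma(0)=0$ and $\xi:I\to S^2$ be real analytic. The ruled surface is $F:I\times\mathbb{R}\to\mathbb{R}^3$, $F(x,t)=\gamma(x)+t\xi(x)$. It is called $k$-th pseudo cylindrical ($k\in\mathbb{Z}_{\ge 0}$) if $\xi'(x)=\tilde\xi(x)x^{k}$ with $\tilde\xi(0)\neq\mathbf 0$; $I$ is taken so small that $\tilde\xi$ has no zeros on $I$. Put $\xi_d=\tilde\xi/\|\tilde\xi\|$, so $\{\xi,\xi_d,\xi\times\xi_d\}$ is an orthonormal frame, and $\delta(x)=\langle\xi'(x),\xi_d(x)\rangle=\|\tilde\xi(x)\|x^{k}$. The functions $p,q,r:I\to\mathbb{R}$ are defined by $\gamma'=p\,\xi+q\,\xi_d+r\,(\xi\times\xi_d)$. $F$ is a developable surface (vanishing Gaussian curvature on the regular part), equivalently $r\equiv 0$. The unit normal vector field is $\nu=\xi\times\xi_d$; the signed area density is $\lambda=\det(F_x,F_t,\nu)=-(q(x)+t\delta(x))$; the null vector field is $\eta=\partial_x-p(x)\partial_t$, which spans $\operatorname{Ker} dF$ at singular points. $\eta^{(n)}\lambda$ denotes $\eta$ applied $n$ times to $\lambda$, and $\sigma^{(n)}$ is the $n$-th derivative of $\sigma$. *)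

theory Defs
  imports "HOL-Analysis.Analysis"
begin

text \<open>Meant for open \<open>S\<close>: the ball of convergence may be shrunk so as to lie inside \<open>S\<close>,
  hence values of \<open>f\<close> outside \<open>S\<close> play no role.\<close>

definition real_analytic_on :: "(real \<Rightarrow> 'a::real_normed_vector) \<Rightarrow> real set \<Rightarrow> bool"
    (infixl \<open>real'_analytic'_on\<close> 50) where
  "f real_analytic_on S \<longleftrightarrow>
     (\<forall>a\<in>S. \<exists>r>0. \<exists>c. \<forall>x\<in>ball a r. (\<lambda>n. (x - a) ^ n *\<^sub>R c n) sums f x)"

definition partial_x :: "(real \<times> real \<Rightarrow> 'a::real_normed_vector) \<Rightarrow> real \<times> real \<Rightarrow> 'a" where
  "partial_x f z = vector_derivative (\<lambda>s. f (s, snd z)) (at (fst z))"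

definition partial_t :: "(real \<times> real \<Rightarrow> 'a::real_normed_vector) \<Rightarrow> real \<times> real \<Rightarrow> 'a" where
  "partial_t f z = vector_derivative (\<lambda>s. f (fst z, s)) (at (snd z))"


subsection \<open>Parametrized surfaces in three-space\<close>

definition regular_point :: "(real \<times> real \<Rightarrow> real^3) \<Rightarrow> real \<times> real \<Rightarrow> bool" where
  "regular_point F z \<longleftrightarrow> cross3 (partial_x F z) (partial_t F z) \<noteq> 0"

text \<open>Quotient of the determinants of the second and first fundamental forms; meaningful at
  regular points only.\<close>

definition gaussian_curvature :: "(real \<times> real \<Rightarrow> real^3) \<Rightarrow> real \<times> real \<Rightarrow> real" where
  "gaussian_curvature F z =
    (let Fx = partial_x F z; Ft = partial_t F z;
         N = cross3 Fx Ft /\<^sub>R norm (cross3 Fx Ft);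
         e = partial_x (partial_x F) z \<bullet> N;
         f = partial_t (partial_x F) z \<bullet> N;
         g = partial_t (partial_t F) z \<bullet> N
     in (e * g - f\<^sup>2) / ((Fx \<bullet> Fx) * (Ft \<bullet> Ft) - (Fx \<bullet> Ft)\<^sup>2))"

definition developable_on :: "(real \<times> real \<Rightarrow> real^3) \<Rightarrow> (real \<times> real) set \<Rightarrow> bool" where
  "developable_on F U \<longleftrightarrow> (\<forall>z\<in>U. regular_point F z \<longrightarrow> gaussian_curvature F z = 0)"


subsection \<open>Pseudo cylindrical ruled surfaces\<close>

definition ruled_surface :: "(real \<Rightarrow> real^3) \<Rightarrow> (real \<Rightarrow> real^3) \<Rightarrow> real \<times> real \<Rightarrow> real^3" where
  "ruled_surface \<gamma> \<xi> = (\<lambda>(x, t). \<gamma> x + t *\<^sub>R \<xi> x)"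

text \<open>The factor \<open>\<xi>t\<close> in \<open>\<xi>' = x\<^sup>k \<xi>t\<close> is required to be analytic; otherwise its value at \<open>0\<close>
  would be unconstrained when \<open>k > 0\<close>. It has no zeros on all of \<open>I\<close>, not only at \<open>0\<close>.\<close>

definition pseudo_cylindrical ::
    "nat \<Rightarrow> real set \<Rightarrow> (real \<Rightarrow> real^3) \<Rightarrow> (real \<Rightarrow> real^3) \<Rightarrow> bool" where
  "pseudo_cylindrical k I \<xi> \<xi>t \<longleftrightarrow>
     \<xi>t real_analytic_on I \<and>
     (\<forall>x\<in>I. vector_derivative \<xi> (at x) = x ^ k *\<^sub>R \<xi>t x) \<and>
     (\<forall>x\<in>I. \<xi>t x \<noteq> 0)"

definition xi_d :: "(real \<Rightarrow> real^3) \<Rightarrow> real \<Rightarrow> real^3" where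
  "xi_d \<xi>t x = \<xi>t x /\<^sub>R norm (\<xi>t x)"

definition delta :: "(real \<Rightarrow> real^3) \<Rightarrow> (real \<Rightarrow> real^3) \<Rightarrow> real \<Rightarrow> real" where
  "delta \<xi> \<xi>t x = vector_derivative \<xi> (at x) \<bullet> xi_d \<xi>t x"

definition unit_normal :: "(real \<Rightarrow> real^3) \<Rightarrow> (real \<Rightarrow> real^3) \<Rightarrow> real \<Rightarrow> real^3" where
  "unit_normal \<xi> \<xi>t x = cross3 (\<xi> x) (xi_d \<xi>t x)"

definition signed_area_density ::
    "(real \<Rightarrow> real^3) \<Rightarrow> (real \<Rightarrow> real^3) \<Rightarrow> (real \<Rightarrow> real^3) \<Rightarrow> real \<times> real \<Rightarrow> real" where
  "signed_area_density \<gamma> \<xi> \<xi>t z =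
     det (vector [partial_x (ruled_surface \<gamma> \<xi>) z, partial_t (ruled_surface \<gamma> \<xi>) z,
                  unit_normal \<xi> \<xi>t (fst z)] :: real^3^3)"

definition null_field :: "(real \<Rightarrow> real) \<Rightarrow> (real \<times> real \<Rightarrow> real) \<Rightarrow> real \<times> real \<Rightarrow> real" where
  "null_field p f z = partial_x f z - p (fst z) * partial_t f z"

text \<open>The analytic extension of \<open>- q / \<delta>\<close> across \<open>0\<close>, where \<open>q = qt x\<^sup>Q\<close>.\<close>

definition singular_param ::
    "(real \<Rightarrow> real^3) \<Rightarrow> (real \<Rightarrow> real) \<Rightarrow> nat \<Rightarrow> nat \<Rightarrow> real \<Rightarrow> real" where
  "singular_param \<xi>t qt Q k x = - (qt x / norm (\<xi>t x)) * x ^ (Q - k)"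

text \<open>\<open>(q / \<delta>)'\<close> is read as \<open>- t'\<close> with \<open>t\<close> the analytic extension, since \<open>\<delta> 0 = 0\<close> for \<open>k > 0\<close>.\<close>

definition sigma_fun ::
    "(real \<Rightarrow> real^3) \<Rightarrow> (real \<Rightarrow> real^3) \<Rightarrow> (real \<Rightarrow> real) \<Rightarrow> (real \<Rightarrow> real) \<Rightarrow> nat \<Rightarrow> nat \<Rightarrow> real \<Rightarrow> real"
  where
  "sigma_fun \<xi> \<xi>t p qt Q k x = delta \<xi> \<xi>t x * (p x + deriv (singular_param \<xi>t qt Q k) x)"

end

theory Submission
  imports Defs
begin

text \<open>With \<open>\<tau>\<close> the parameter of the singular curve, \<open>\<lambda> = \<delta> (\<tau> - t)\<close>, and the null field maps
  \<open>\<tau> - t\<close> to \<open>s = p + \<tau>'\<close>, so on the curve the iterates \<open>\<eta>\<^sup>n \<lambda>\<close> are Leibniz sums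
  in the derivatives of \<open>\<delta>\<close> and the sequence \<open>0, s, s', s'', \<dots>\<close>, while \<open>\<sigma>\<^sup>(\<^sup>n\<^sup>)\<close> is the Leibniz
  sum of \<open>\<delta> s\<close>. As \<open>\<delta>\<close> vanishes exactly to order \<open>k\<close> at \<open>0\<close>, a Leibniz sum sequence starts with
  \<open>N\<close> zeros iff the first \<open>N - k\<close> terms of its other factor vanish; the binomial weights, which
  differ between the two sums, do not matter.\<close>

section \<open>Leibniz sums of two sequences and their initial zeros\<close>

text \<open>The arguments are sequences rather than functions because the second factor met later,
  \<open>\<tau> x - t\<close> followed by the derivatives of \<open>s\<close>, does not consist of
  the successive derivatives of one function of \<open>x\<close>.\<close>

definition leibniz_sum :: "nat \<Rightarrow> (nat \<Rightarrow> real) \<Rightarrow> (nat \<Rightarrow> real) \<Rightarrow> real" where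
  "leibniz_sum n a b = (\<Sum>j\<le>n. real (n choose j) * (a (n - j) * b j))"

lemma leibniz_sum_0 [simp]: "leibniz_sum 0 a b = a 0 * b 0"
  by (simp add: leibniz_sum_def)

text \<open>Pascal's rule: one more differentiation falls either on the first factor or on the
  second.\<close>

lemma leibniz_sum_Suc:
  "leibniz_sum (Suc n) a b = leibniz_sum n (\<lambda>j. a (Suc j)) b + leibniz_sum n a (\<lambda>j. b (Suc j))"
proof -
  have 1: "leibniz_sum n (\<lambda>j. a (Suc j)) b
      = a (Suc n) * b 0 + (\<Sum>j\<le>n. real (n choose Suc j) * (a (n - j) * b (Suc j)))"
  proof -
    \<comment> \<open>The range may be extended to \<open>Suc n\<close> since the new weight
      \<open>n choose Suc n\<close> is zero.\<close>
    have "leibniz_sum n (\<lambda>j. a (Suc j)) b = (\<Sum>j\<le>Suc n. real (n choose j) * (a (Suc n - j) * b j))"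
      by (simp add: leibniz_sum_def Suc_diff_le)
    also have "\<dots> = a (Suc n) * b 0 + (\<Sum>j\<le>n. real (n choose Suc j) * (a (n - j) * b (Suc j)))"
      by (subst sum.atMost_Suc_shift) simp
    finally show ?thesis .
  qed
  have "leibniz_sum (Suc n) a b
      = a (Suc n) * b 0 + (\<Sum>j\<le>n. real (Suc n choose Suc j) * (a (n - j) * b (Suc j)))"
    unfolding leibniz_sum_def by (subst sum.atMost_Suc_shift) simp
  also have "\<dots> = leibniz_sum n (\<lambda>j. a (Suc j)) b + leibniz_sum n a (\<lambda>j. b (Suc j))"
    unfolding 1 by (simp add: leibniz_sum_def algebra_simps sum.distrib)
  finally show ?thesis .
qed

text \<open>The derivatives \<open>a'\<close> and \<open>b'\<close> are arbitrary sequences, not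
  shifts of \<open>a\<close> and \<open>b\<close>: for the null field, entry 0 of the second factor
  has x-derivative \<open>deriv \<tau> x\<close>, which is not its entry 1.\<close>

lemma leibniz_sum_has_real_derivative:
  assumes "\<And>j. (a j has_real_derivative a' j) (at x)"
    and "\<And>j. (b j has_real_derivative b' j) (at x)"
  shows "((\<lambda>x. leibniz_sum n (\<lambda>j. a j x) (\<lambda>j. b j x)) has_real_derivative
           leibniz_sum n a' (\<lambda>j. b j x) + leibniz_sum n (\<lambda>j. a j x) b') (at x)"
  unfolding leibniz_sum_def
  by (auto intro!: derivative_eq_intros assms simp: sum.distrib algebra_simps)

text \<open>Induction on \<open>N\<close>. Once \<open>b j = 0\<close> for all
  \<open>j + k < N\<close>, only the index \<open>j = N - k\<close> can contribute to the sum at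
  \<open>N\<close>: smaller indices meet a zero of \<open>b\<close>, larger ones a zero of
  \<open>a\<close>. The surviving term is \<open>b (N - k)\<close> times a nonzero number, so the
  sum vanishes exactly when the next entry of \<open>b\<close> does.\<close>

lemma leibniz_sum_initial_zeros_iff:
  assumes low: "\<And>i. i < k \<Longrightarrow> a i = 0" and ak: "a k \<noteq> 0"
  shows "(\<forall>i<N. leibniz_sum i a b = 0) \<longleftrightarrow> (\<forall>j. j + k < N \<longrightarrow> b j = 0)"
proof (induction N)
  case (Suc N)
  show ?case
  proof (cases "\<forall>j. j + k < N \<longrightarrow> b j = 0")
    case True
    \<comment> \<open>For \<open>N < k\<close> the truncated difference \<open>N - k\<close> is 0
      and names no surviving term; the conditional then gives the value 0.\<close>
    have "leibniz_sum N a b = (if k \<le> N then real (N choose (N - k)) * (a k * b (N - k)) else 0)"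
    proof -
      have "real (N choose j) * (a (N - j) * b j)
          = (if j = N - k then if k \<le> N then real (N choose (N - k)) * (a k * b (N - k)) else 0 else 0)"
        if "j \<le> N" for j
      proof -
        consider "j + k < N" | "N < j + k" | "j + k = N" by linarith
        then show ?thesis
        proof cases
          case 1
          then show ?thesis using True by auto
        next
          case 2
          then have "a (N - j) = 0" using that by (intro low) linarith
          then show ?thesis using 2 by auto
        qed auto
      qed
      then have "leibniz_sum N a b = (\<Sum>j\<le>N. if j = N - k then if k \<le> N then real (N choose (N - k)) * (a k * b (N - k)) else 0 else 0)"
        unfolding leibniz_sum_def by (intro sum.cong) auto
      then show ?thesis by simp
    qed
    then have "leibniz_sum N a b = 0 \<longleftrightarrow> (k \<le> N \<longrightarrow> b (N - k) = 0)"
      using ak by auto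
    moreover have "(\<forall>j. j + k < Suc N \<longrightarrow> b j = 0) \<longleftrightarrow> (k \<le> N \<longrightarrow> b (N - k) = 0)"
    proof -
      have "j + k < Suc N \<longleftrightarrow> j + k < N \<or> (k \<le> N \<and> j = N - k)" for j by auto
      then show ?thesis using True by auto
    qed
    ultimately show ?thesis using Suc True by (auto simp: less_Suc_eq)
  next
    case False
    then show ?thesis using Suc by (meson less_SucI)
  qed
qed simp

section \<open>Smooth real functions on a set and their closure properties\<close>

text \<open>This is n-fold differentiability, with no continuity of the last derivative; for all
  \<open>n\<close> together it is the usual smoothness on an open set. The derivative is an
  existential witness, so explicit formulas can be supplied in the closure proofs.\<close>

primrec Ck_on :: "nat \<Rightarrow> real set \<Rightarrow> (real \<Rightarrow> real) \<Rightarrow> bool" where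
  "Ck_on 0 S f \<longleftrightarrow> True"
| "Ck_on (Suc n) S f \<longleftrightarrow> (\<exists>f'. (\<forall>x\<in>S. (f has_real_derivative f' x) (at x)) \<and> Ck_on n S f')"

definition smooth_on :: "real set \<Rightarrow> (real \<Rightarrow> real) \<Rightarrow> bool" where
  "smooth_on S f \<longleftrightarrow> (\<forall>n. Ck_on n S f)"

text \<open>The derivative of a product contains the undifferentiated factors, so inductions on the
  order must be able to lower the order of these.\<close>

lemma Ck_on_SucD: "Ck_on (Suc n) S f \<Longrightarrow> Ck_on n S f"
proof (induction n arbitrary: f)
  case (Suc n)
  then obtain f' where "\<forall>x\<in>S. (f has_real_derivative f' x) (at x)" "Ck_on (Suc n) S f'"
    by (auto simp only: Ck_on.simps(2)[of "Suc n"])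
  then show ?case using Suc.IH by (subst Ck_on.simps) blast
qed simp

lemma has_real_derivative_cong_open:
  assumes "open S" "x \<in> S" "\<And>y. y \<in> S \<Longrightarrow> f y = g y"
  shows "(f has_real_derivative D) (at x) \<longleftrightarrow> (g has_real_derivative D) (at x)"
  using assms by (intro DERIV_cong_ev) (auto simp: eventually_nhds)

lemma Ck_on_cong:
  assumes "open S" "\<And>y. y \<in> S \<Longrightarrow> f y = g y" "Ck_on n S f"
  shows "Ck_on n S g"
proof (cases n)
  case (Suc m)
  then show ?thesis
    using assms(3) has_real_derivative_cong_open[OF assms(1) _ assms(2)] by auto
qed simp

lemma smooth_on_cong:
  assumes "open S" "\<And>y. y \<in> S \<Longrightarrow> f y = g y" "smooth_on S f"
  shows "smooth_on S g"
  using assms unfolding smooth_on_def by (blast intro: Ck_on_cong)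

lemma smooth_on_has_deriv:
  assumes "smooth_on S f" "x \<in> S"
  shows "(f has_real_derivative deriv f x) (at x)"
proof -
  have "Ck_on (Suc 0) S f" using assms(1) by (simp only: smooth_on_def)
  then show ?thesis using assms(2) DERIV_imp_deriv by fastforce
qed

lemma smooth_on_deriv:
  assumes "open S" "smooth_on S f"
  shows "smooth_on S (deriv f)"
  unfolding smooth_on_def
proof
  fix n
  have "Ck_on (Suc n) S f" using assms(2) by (simp only: smooth_on_def)
  then obtain f' where f': "\<forall>x\<in>S. (f has_real_derivative f' x) (at x)" "Ck_on n S f'"
    by auto
  show "Ck_on n S (deriv f)"
    using f'(1) by (intro Ck_on_cong[OF assms(1) _ f'(2)]) (metis DERIV_imp_deriv)
qed

lemma smooth_on_funpow_deriv:
  "open S \<Longrightarrow> smooth_on S f \<Longrightarrow> smooth_on S ((deriv ^^ n) f)"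
  by (induction n) (auto intro: smooth_on_deriv)

lemma smooth_on_funpow_has_deriv:
  assumes "open S" "smooth_on S f" "x \<in> S"
  shows "((deriv ^^ n) f has_real_derivative (deriv ^^ Suc n) f x) (at x)"
  using smooth_on_has_deriv[OF smooth_on_funpow_deriv[OF assms(1,2)] assms(3)] by simp

lemma Ck_on_const: "Ck_on n S (\<lambda>x. c)"
proof (induction n arbitrary: c)
  case (Suc n)
  then show ?case by (auto intro!: exI[of _ "\<lambda>x. 0"])
qed simp

lemma smooth_on_const: "smooth_on S (\<lambda>x. c)"
  by (simp add: smooth_on_def Ck_on_const)

lemma smooth_on_ident: "smooth_on S (\<lambda>x. x)"
  unfolding smooth_on_def
proof
  show "Ck_on n S (\<lambda>x. x)" for n
    by (cases n) (auto intro!: exI[of _ "\<lambda>x. 1"] Ck_on_const)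
qed

lemma Ck_on_add: "Ck_on n S f \<Longrightarrow> Ck_on n S g \<Longrightarrow> Ck_on n S (\<lambda>x. f x + g x)"
proof (induction n arbitrary: f g)
  case (Suc n)
  then obtain f' g' where "\<forall>x\<in>S. (f has_real_derivative f' x) (at x)" "Ck_on n S f'"
    "\<forall>x\<in>S. (g has_real_derivative g' x) (at x)" "Ck_on n S g'" by auto
  with Suc.IH show ?case
    by (auto intro!: exI[of _ "\<lambda>x. f' x + g' x"] derivative_eq_intros)
qed simp

lemma Ck_on_mult: "Ck_on n S f \<Longrightarrow> Ck_on n S g \<Longrightarrow> Ck_on n S (\<lambda>x. f x * g x)"
proof (induction n arbitrary: f g)
  case (Suc n)
  then obtain f' g' where "\<forall>x\<in>S. (f has_real_derivative f' x) (at x)" "Ck_on n S f'"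
    "\<forall>x\<in>S. (g has_real_derivative g' x) (at x)" "Ck_on n S g'" by auto
  moreover have "Ck_on n S (\<lambda>x. f' x * g x + f x * g' x)"
    using calculation Suc.prems[THEN Ck_on_SucD] by (intro Ck_on_add Suc.IH)
  ultimately show ?case
    by (auto intro!: exI[of _ "\<lambda>x. f' x * g x + f x * g' x"] derivative_eq_intros)
qed simp

text \<open>The derivative of \<open>1/f\<close> is \<open>-f'/f^2\<close>, which contains
  \<open>1/f\<close> again; the induction hypothesis supplies that factor at the lower order. The
  square root below is treated the same way, with derivative \<open>f'/(2 sqrt f)\<close>.\<close>

lemma Ck_on_inverse:
  assumes "Ck_on n S f" "\<And>x. x \<in> S \<Longrightarrow> f x \<noteq> 0"
  shows "Ck_on n S (\<lambda>x. inverse (f x))"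
  using assms(1)
proof (induction n)
  case (Suc n)
  then obtain f' where f': "\<forall>x\<in>S. (f has_real_derivative f' x) (at x)" "Ck_on n S f'" by auto
  have "Ck_on n S (\<lambda>x. inverse (f x))"
    using Suc.IH[OF Ck_on_SucD[OF Suc.prems]] .
  then have "Ck_on n S (\<lambda>x. - 1 * (f' x * (inverse (f x) * inverse (f x))))"
    using f'(2) by (intro Ck_on_mult Ck_on_const)
  moreover have "\<forall>x\<in>S. ((\<lambda>x. inverse (f x)) has_real_derivative
      - 1 * (f' x * (inverse (f x) * inverse (f x)))) (at x)"
    using f'(1) assms(2) by (auto intro!: derivative_eq_intros)
  ultimately show ?case by (subst Ck_on.simps) (rule exI conjI | assumption)+
qed simp

lemma Ck_on_sqrt:
  assumes "Ck_on n S f" "\<And>x. x \<in> S \<Longrightarrow> f x > 0"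
  shows "Ck_on n S (\<lambda>x. sqrt (f x))"
  using assms(1)
proof (induction n)
  case (Suc n)
  then obtain f' where f': "\<forall>x\<in>S. (f has_real_derivative f' x) (at x)" "Ck_on n S f'" by auto
  have "Ck_on n S (\<lambda>x. sqrt (f x))"
    using Suc.IH[OF Ck_on_SucD[OF Suc.prems]] .
  then have "Ck_on n S (\<lambda>x. f' x * (1 / 2 * inverse (sqrt (f x))))"
    using f'(2) assms(2) by (intro Ck_on_mult Ck_on_const Ck_on_inverse) (auto dest: assms(2))
  moreover have "\<forall>x\<in>S. ((\<lambda>x. sqrt (f x)) has_real_derivative
      f' x * (1 / 2 * inverse (sqrt (f x)))) (at x)"
  proof
    fix x assume "x \<in> S"
    with f'(1) assms(2)[of x]
    show "((\<lambda>x. sqrt (f x)) has_real_derivative f' x * (1 / 2 * inverse (sqrt (f x)))) (at x)"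
      by (auto intro!: derivative_eq_intros simp: field_simps)
  qed
  ultimately show ?case by (subst Ck_on.simps) (rule exI conjI | assumption)+
qed simp

lemma smooth_on_add: "smooth_on S f \<Longrightarrow> smooth_on S g \<Longrightarrow> smooth_on S (\<lambda>x. f x + g x)"
  by (simp add: smooth_on_def Ck_on_add)

lemma smooth_on_mult: "smooth_on S f \<Longrightarrow> smooth_on S g \<Longrightarrow> smooth_on S (\<lambda>x. f x * g x)"
  by (simp add: smooth_on_def Ck_on_mult)

lemma smooth_on_power: "smooth_on S f \<Longrightarrow> smooth_on S (\<lambda>x. f x ^ n)"
  by (induction n) (simp_all add: smooth_on_const smooth_on_mult)

lemma smooth_on_divide:
  "smooth_on S f \<Longrightarrow> smooth_on S g \<Longrightarrow> (\<And>x. x \<in> S \<Longrightarrow> g x \<noteq> 0) \<Longrightarrow> smooth_on S (\<lambda>x. f x / g x)"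
  by (simp add: smooth_on_def divide_inverse Ck_on_mult Ck_on_inverse)

lemma smooth_on_sqrt:
  "smooth_on S f \<Longrightarrow> (\<And>x. x \<in> S \<Longrightarrow> f x > 0) \<Longrightarrow> smooth_on S (\<lambda>x. sqrt (f x))"
  by (simp add: smooth_on_def Ck_on_sqrt)

lemma smooth_on_uminus: "smooth_on S f \<Longrightarrow> smooth_on S (\<lambda>x. - f x)"
  using smooth_on_mult[OF smooth_on_const[of S "- 1"]] by simp

lemma smooth_on_sum:
  "(\<And>i. i \<in> A \<Longrightarrow> smooth_on S (f i)) \<Longrightarrow> smooth_on S (\<lambda>x. \<Sum>i\<in>A. f i x)"
  by (induction A rule: infinite_finite_induct) (simp_all add: smooth_on_const smooth_on_add)

lemma smooth_on_inner:
  fixes f g :: "real \<Rightarrow> real^'n"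
  assumes "\<And>i. smooth_on S (\<lambda>x. f x $ i)" "\<And>i. smooth_on S (\<lambda>x. g x $ i)"
  shows "smooth_on S (\<lambda>x. f x \<bullet> g x)"
  unfolding inner_vec_def inner_real_def
  by (intro smooth_on_sum smooth_on_mult assms)

lemma smooth_on_norm:
  fixes f :: "real \<Rightarrow> real^'n"
  assumes "\<And>i. smooth_on S (\<lambda>x. f x $ i)" "\<And>x. x \<in> S \<Longrightarrow> f x \<noteq> 0"
  shows "smooth_on S (\<lambda>x. norm (f x))"
  unfolding norm_eq_sqrt_inner
  using assms by (intro smooth_on_sqrt smooth_on_inner) auto

section \<open>Iterated derivatives of products and powers\<close>

text \<open>Identifies iterated derivatives with an explicit chain of formulas. Openness matters:
  equality of the n-th derivatives must hold on a neighbourhood before it can be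
  differentiated.\<close>

lemma funpow_deriv_eqI:
  assumes "open S" "\<And>x. x \<in> S \<Longrightarrow> f x = d 0 x"
    and d: "\<And>n x. x \<in> S \<Longrightarrow> (d n has_real_derivative d (Suc n) x) (at x)"
    and "x \<in> S"
  shows "(deriv ^^ n) f x = d n x"
  using assms(4)
proof (induction n arbitrary: x)
  case (Suc n)
  have "((deriv ^^ n) f has_real_derivative d (Suc n) x) (at x)"
    using has_real_derivative_cong_open[OF assms(1) Suc.prems, of "(deriv ^^ n) f" "d n"]
      Suc.IH d[OF Suc.prems] by simp
  then show ?case by (simp add: DERIV_imp_deriv)
qed (simp add: assms)

lemma funpow_deriv_mult:
  assumes S: "open S" and f: "smooth_on S f" and g: "smooth_on S g"
    and h: "\<And>x. x \<in> S \<Longrightarrow> h x = f x * g x" and "x \<in> S"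
  shows "(deriv ^^ n) h x = leibniz_sum n (\<lambda>j. (deriv ^^ j) f x) (\<lambda>j. (deriv ^^ j) g x)"
proof (rule funpow_deriv_eqI[OF S _ _ \<open>x \<in> S\<close>])
  fix n x assume "x \<in> S"
  show "((\<lambda>x. leibniz_sum n (\<lambda>j. (deriv ^^ j) f x) (\<lambda>j. (deriv ^^ j) g x)) has_real_derivative
      leibniz_sum (Suc n) (\<lambda>j. (deriv ^^ j) f x) (\<lambda>j. (deriv ^^ j) g x)) (at x)"
    unfolding leibniz_sum_Suc
    by (intro leibniz_sum_has_real_derivative smooth_on_funpow_has_deriv[OF S] f g \<open>x \<in> S\<close>)
qed (simp add: h)

text \<open>The coefficient is the falling factorial k(k-1)...(k-j+1). For \<open>j > k\<close> the
  binomial coefficient makes it zero, although \<open>x ^ (k - j)\<close> is then 1.\<close>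

lemma funpow_deriv_power:
  "(deriv ^^ j) (\<lambda>x::real. x ^ k) x = fact j * real (k choose j) * x ^ (k - j)"
proof (rule funpow_deriv_eqI[of UNIV])
  fix j and x :: real
  have "real (k choose j) * real (k - j) = real (Suc j) * real (k choose Suc j)"
    by (metis Suc_times_binomial_eq binomial_absorb_comp binomial_absorption mult.commute of_nat_mult)
  then have eq: "fact j * real (k choose j) * real (k - j) = fact (Suc j) * real (k choose Suc j)"
    by (simp add: algebra_simps)
  have "((\<lambda>x. fact j * real (k choose j) * x ^ (k - j)) has_real_derivative
      fact j * real (k choose j) * real (k - j) * x ^ (k - Suc j)) (at x)"
    by (auto intro!: derivative_eq_intros)
  then show "((\<lambda>x. fact j * real (k choose j) * x ^ (k - j)) has_real_derivative
      fact (Suc j) * real (k choose Suc j) * x ^ (k - Suc j)) (at x)"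
    unfolding eq .
qed auto

text \<open>At 0 the only nonzero derivative of the power is the k-th, equal to k!. The Leibniz sum
  of order \<open>i\<close> thus reduces to its term \<open>j = k\<close>, which is absent for
  \<open>i < k\<close>.\<close>

lemma funpow_deriv_power_mult_0:
  assumes S: "open S" "0 \<in> S" and f: "smooth_on S f"
    and h: "\<And>x. x \<in> S \<Longrightarrow> h x = x ^ k * f x"
  shows "i < k \<Longrightarrow> (deriv ^^ i) h 0 = 0"
    and "(deriv ^^ k) h 0 = fact k * f 0"
proof -
  have pow: "(deriv ^^ j) (\<lambda>x::real. x ^ k) 0 = (if j = k then fact k else 0)" for j
    by (auto simp: funpow_deriv_power power_0_left)
  have "(deriv ^^ i) h 0 = (if i < k then 0 else real (i choose k) * ((deriv ^^ (i - k)) f 0 * fact k))" for i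
  proof -
    have "(deriv ^^ i) h 0 = leibniz_sum i (\<lambda>j. (deriv ^^ j) f 0) (\<lambda>j. if j = k then fact k else 0)"
      by (subst funpow_deriv_mult[OF S(1) f smooth_on_power[OF smooth_on_ident, of _ k] _ S(2)])
        (simp_all add: h pow mult.commute)
    also have "\<dots> = (\<Sum>j\<le>i. if j = k then real (i choose k) * ((deriv ^^ (i - k)) f 0 * fact k) else 0)"
      unfolding leibniz_sum_def by (intro sum.cong) auto
    finally show ?thesis by auto
  qed
  then show "i < k \<Longrightarrow> (deriv ^^ i) h 0 = 0" "(deriv ^^ k) h 0 = fact k * f 0"
    by simp_all
qed

section \<open>Real analytic functions, and curves treated by components\<close>

text \<open>Termwise differentiation of the power series at each centre, with the same radius and
  with coefficients \<open>diffs c\<close>.\<close>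

lemma real_analytic_on_deriv:
  fixes f :: "real \<Rightarrow> real"
  assumes "f real_analytic_on S"
  obtains f' where "\<And>x. x \<in> S \<Longrightarrow> (f has_real_derivative f' x) (at x)" "f' real_analytic_on S"
proof -
  \<comment> \<open>Naming the derivative \<open>deriv f\<close> gives one function for all centres,
    so the local expansions need not be glued.\<close>
  have *: "\<exists>r>0. \<exists>c. \<forall>x\<in>ball a r. (f has_real_derivative deriv f x) (at x) \<and>
      (\<lambda>n. (x - a) ^ n *\<^sub>R c n) sums deriv f x" if a: "a \<in> S" for a
  proof -
    obtain r c where r: "r > 0" and c: "\<And>x. x \<in> ball a r \<Longrightarrow> (\<lambda>n. (x - a) ^ n *\<^sub>R c n) sums f x"
      using assms a unfolding real_analytic_on_def by blast
    have sm: "summable (\<lambda>n. c n * z ^ n)" if "norm z < r" for z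
      using c[of "a + z"] that by (simp add: dist_norm sums_iff mult.commute)
    have "(f has_real_derivative deriv f x) (at x) \<and> (\<lambda>n. (x - a) ^ n *\<^sub>R diffs c n) sums deriv f x"
      if x: "x \<in> ball a r" for x
    proof -
      have xr: "norm (x - a) < r" using x by (simp add: dist_norm norm_minus_commute)
      have "((\<lambda>z. \<Sum>n. c n * z ^ n) has_real_derivative (\<Sum>n. diffs c n * (x - a) ^ n)) (at (x - a))"
        using sm xr by (intro termdiffs_strong') auto
      then have "((\<lambda>x. \<Sum>n. c n * (x - a) ^ n) has_real_derivative (\<Sum>n. diffs c n * (x - a) ^ n)) (at x)"
        using DERIV_shift[of "\<lambda>z. \<Sum>n. c n * z ^ n" _ x "- a"] by simp
      moreover have "(\<Sum>n. c n * (y - a) ^ n) = f y" if "y \<in> ball a r" for y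
        using c[OF that] by (simp add: sums_iff mult.commute)
      ultimately have D: "(f has_real_derivative (\<Sum>n. diffs c n * (x - a) ^ n)) (at x)"
        using has_real_derivative_cong_open[OF open_ball x, of "\<lambda>x. \<Sum>n. c n * (x - a) ^ n" f] by simp
      moreover have "summable (\<lambda>n. diffs c n * (x - a) ^ n)"
        using sm xr by (intro termdiff_converges[of _ r]) auto
      ultimately show ?thesis
        by (simp add: DERIV_imp_deriv sums_iff mult.commute)
    qed
    then show ?thesis using r by blast
  qed
  show ?thesis
  proof
    show "(f has_real_derivative deriv f x) (at x)" if "x \<in> S" for x
      using *[OF that] by auto
    show "deriv f real_analytic_on S"
      unfolding real_analytic_on_def using * by meson
  qed
qed

lemma real_analytic_on_imp_smooth_on:
  assumes "f real_analytic_on S"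
  shows "smooth_on S f"
proof -
  have "Ck_on n S f" for n
    using assms
  proof (induction n arbitrary: f)
    case (Suc n)
    obtain f' where "\<And>x. x \<in> S \<Longrightarrow> (f has_real_derivative f' x) (at x)" "f' real_analytic_on S"
      using real_analytic_on_deriv[OF Suc.prems] by blast
    then show ?case using Suc.IH by auto
  qed simp
  then show ?thesis by (simp add: smooth_on_def)
qed

lemma real_analytic_on_imp_smooth_on_nth:
  fixes f :: "real \<Rightarrow> real^'n"
  assumes "f real_analytic_on S"
  shows "smooth_on S (\<lambda>x. f x $ i)"
proof (rule real_analytic_on_imp_smooth_on, unfold real_analytic_on_def, intro ballI)
  fix a assume "a \<in> S"
  then obtain r c where r: "r > 0" and c: "\<And>x. x \<in> ball a r \<Longrightarrow> (\<lambda>n. (x - a) ^ n *\<^sub>R c n) sums f x"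
    using assms unfolding real_analytic_on_def by blast
  have "(\<lambda>n. (x - a) ^ n *\<^sub>R (c n $ i)) sums (f x $ i)" if "x \<in> ball a r" for x
    using bounded_linear.sums[OF bounded_linear_vec_nth c[OF that], of i] by simp
  with r show "\<exists>r>0. \<exists>c. \<forall>x\<in>ball a r. (\<lambda>n. (x - a) ^ n *\<^sub>R c n) sums (f x $ i)"
    by (intro exI[of _ r] conjI exI[of _ "\<lambda>n. c n $ i"] ballI)
qed

lemma smooth_on_nth_has_vector_derivative:
  fixes f :: "real \<Rightarrow> real^'n"
  assumes "\<And>i. smooth_on S (\<lambda>x. f x $ i)" "x \<in> S"
  shows "(f has_vector_derivative (\<chi> i. deriv (\<lambda>x. f x $ i) x)) (at x)"
  unfolding has_vector_derivative_def
proof (subst has_derivative_componentwise_within, intro ballI)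
  fix b :: "real^'n" assume "b \<in> Basis"
  then obtain i where b: "b = axis i 1" by (auto simp: Basis_vec_def)
  show "((\<lambda>x. f x \<bullet> b) has_derivative (\<lambda>h. (h *\<^sub>R (\<chi> i. deriv (\<lambda>x. f x $ i) x)) \<bullet> b)) (at x)"
    using smooth_on_has_deriv[OF assms(1)[of i] assms(2)]
    by (simp add: b inner_axis has_field_derivative_def mult.commute[of _ "deriv _ _"])
qed

section \<open>Iterates of the null field\<close>

text \<open>The \<open>case_nat\<close> sequence lists the iterates of the null field on \<open>\<tau> - t\<close>.\<close>

lemma funpow_null_field_eq:
  assumes I: "open I" and d: "smooth_on I d" and \<tau>: "smooth_on I \<tau>" and p: "smooth_on I p"
    and \<Lambda>: "\<And>x t. x \<in> I \<Longrightarrow> \<Lambda> (x, t) = d x * (\<tau> x - t)"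
    and "x \<in> I"
  shows "(null_field p ^^ n) \<Lambda> (x, t) = leibniz_sum n (\<lambda>j. (deriv ^^ j) d x)
     (case_nat (\<tau> x - t) (\<lambda>j. (deriv ^^ j) (\<lambda>x. p x + deriv \<tau> x) x))"
  using \<open>x \<in> I\<close>
proof (induction n arbitrary: x t)
  case 0
  then show ?case by (simp add: \<Lambda>)
next
  case (Suc n)
  define s where "s = (\<lambda>x. p x + deriv \<tau> x)"
  have s: "smooth_on I s" unfolding s_def by (intro smooth_on_add p smooth_on_deriv I \<tau>)
  let ?a = "\<lambda>x j. (deriv ^^ j) d x"
  let ?u = "\<lambda>x t. case_nat (\<tau> x - t) (\<lambda>j. (deriv ^^ j) s x)"
  let ?v = "\<lambda>j. (deriv ^^ Suc j) s x"
  have IH: "(null_field p ^^ n) \<Lambda> (y, t) = leibniz_sum n (?a y) (?u y t)" if "y \<in> I" for y t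
    using Suc.IH[OF that] by (simp add: s_def)
  have "((\<lambda>y. leibniz_sum n (?a y) (?u y t)) has_real_derivative
      leibniz_sum n (\<lambda>j. ?a x (Suc j)) (?u x t) + leibniz_sum n (?a x) (case_nat (deriv \<tau> x) ?v)) (at x)"
  proof (rule leibniz_sum_has_real_derivative)
    show "((\<lambda>y. ?u y t j) has_real_derivative case_nat (deriv \<tau> x) ?v j) (at x)" for j
      by (cases j) (auto intro!: derivative_eq_intros smooth_on_has_deriv[OF \<tau> Suc.prems]
          smooth_on_funpow_has_deriv[OF I s Suc.prems, simplified])
  qed (rule smooth_on_funpow_has_deriv[OF I d Suc.prems])
  then have "((\<lambda>y. (null_field p ^^ n) \<Lambda> (y, t)) has_real_derivative
      leibniz_sum n (\<lambda>j. ?a x (Suc j)) (?u x t) + leibniz_sum n (?a x) (case_nat (deriv \<tau> x) ?v)) (at x)"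
    by (subst has_real_derivative_cong_open[OF I Suc.prems IH])
  then have px: "partial_x ((null_field p ^^ n) \<Lambda>) (x, t)
      = leibniz_sum n (\<lambda>j. ?a x (Suc j)) (?u x t) + leibniz_sum n (?a x) (case_nat (deriv \<tau> x) ?v)"
    by (simp add: partial_x_def has_real_derivative_iff_has_vector_derivative vector_derivative_at)
  \<comment> \<open>Only entry 0, \<open>\<tau> x - t\<close>, depends on \<open>t\<close>, with
    derivative -1.\<close>
  have "((\<lambda>t. leibniz_sum n (?a x) (?u x t)) has_real_derivative
      leibniz_sum n (\<lambda>j. 0) (?u x t) + leibniz_sum n (?a x) (case_nat (- 1) (\<lambda>j. 0))) (at t)"
  proof (rule leibniz_sum_has_real_derivative)
    show "((\<lambda>t. ?u x t j) has_real_derivative case_nat (- 1) (\<lambda>j. 0) j) (at t)" for j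
      by (cases j) (auto intro!: derivative_eq_intros)
  qed auto
  then have pt: "partial_t ((null_field p ^^ n) \<Lambda>) (x, t)
      = leibniz_sum n (?a x) (case_nat (- 1) (\<lambda>j. 0))"
    by (simp add: partial_t_def has_real_derivative_iff_has_vector_derivative vector_derivative_at
        IH[OF Suc.prems] leibniz_sum_def)
  have "(null_field p ^^ Suc n) \<Lambda> (x, t)
      = leibniz_sum n (\<lambda>j. ?a x (Suc j)) (?u x t) + (leibniz_sum n (?a x) (case_nat (deriv \<tau> x) ?v)
        - p x * leibniz_sum n (?a x) (case_nat (- 1) (\<lambda>j. 0)))"
    by (simp add: null_field_def px pt)
  \<comment> \<open>In entry 0 the two sums combine to \<open>deriv \<tau> x + p x\<close>, which is
    \<open>s x\<close>. The result is the shift of the sequence \<open>?u\<close>, as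
    \<open>leibniz_sum_Suc\<close> demands.\<close>
  also have "leibniz_sum n (?a x) (case_nat (deriv \<tau> x) ?v)
        - p x * leibniz_sum n (?a x) (case_nat (- 1) (\<lambda>j. 0)) = leibniz_sum n (?a x) (\<lambda>j. (deriv ^^ j) s x)"
    unfolding leibniz_sum_def sum_distrib_left sum_subtractf[symmetric]
    by (intro sum.cong) (auto simp: s_def algebra_simps split: nat.splits)
  finally show ?case unfolding leibniz_sum_Suc s_def by simp
qed

section \<open>The orthonormal frame and the area density\<close>

text \<open>Differentiating the constant square length of \<open>\<xi>\<close> gives
  \<open>x ^ k * (\<xi> x \<bullet> \<xi>t x) = 0\<close>. Away from 0 the power cancels; the value
  at 0 follows by continuity.\<close>

lemma unit_curve_orthogonal_derivative_factor:
  fixes \<xi> \<xi>t :: "real \<Rightarrow> real^'n"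
  assumes I: "open I"
    and \<xi>: "\<And>i. smooth_on I (\<lambda>x. \<xi> x $ i)" "\<forall>x\<in>I. norm (\<xi> x) = 1"
    and \<xi>t: "\<And>i. smooth_on I (\<lambda>x. \<xi>t x $ i)"
    and der: "\<forall>x\<in>I. vector_derivative \<xi> (at x) = x ^ k *\<^sub>R \<xi>t x"
    and x: "x \<in> I"
  shows "\<xi> x \<bullet> \<xi>t x = 0"
proof -
  have nz: "\<xi> y \<bullet> \<xi>t y = 0" if "y \<in> I" "y \<noteq> 0" for y
  proof -
    have v: "(\<xi> has_vector_derivative y ^ k *\<^sub>R \<xi>t y) (at y)"
      using smooth_on_nth_has_vector_derivative[OF \<xi>(1) \<open>y \<in> I\<close>] der that(1)
      by (metis vector_derivative_at)
    have "((\<lambda>x. \<xi> x \<bullet> \<xi> x) has_real_derivative 2 * y ^ k * (\<xi> y \<bullet> \<xi>t y)) (at y)"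
      using v unfolding has_field_derivative_def has_vector_derivative_def
      by (auto intro!: derivative_eq_intros simp: inner_commute)
    moreover have "((\<lambda>x. \<xi> x \<bullet> \<xi> x) has_real_derivative 0) (at y)"
      using has_real_derivative_cong_open[OF I \<open>y \<in> I\<close>, of "\<lambda>x. \<xi> x \<bullet> \<xi> x" "\<lambda>_. 1"] \<xi>(2)
      by (simp add: norm_eq_1)
    ultimately have "2 * y ^ k * (\<xi> y \<bullet> \<xi>t y) = 0" by (rule DERIV_unique)
    then show ?thesis using that by simp
  qed
  show ?thesis
  proof (cases "x = 0")
    case True
    have "isCont (\<lambda>x. \<xi> x \<bullet> \<xi>t x) x"
      using smooth_on_has_deriv[OF smooth_on_inner[OF \<xi>(1) \<xi>t] x] by (rule DERIV_isCont)
    then have "((\<lambda>x. \<xi> x \<bullet> \<xi>t x) \<longlongrightarrow> \<xi> x \<bullet> \<xi>t x) (at x)" by (simp add: isCont_def)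
    moreover have "((\<lambda>x. \<xi> x \<bullet> \<xi>t x) \<longlongrightarrow> 0) (at x)"
    proof (rule tendsto_eventually)
      show "\<forall>\<^sub>F y in at x. \<xi> y \<bullet> \<xi>t y = 0"
        unfolding eventually_at_topological using I x nz True by blast
    qed
    ultimately show ?thesis by (rule LIM_unique)
  qed (simp add: nz x)
qed

text \<open>The determinant is the triple product of its first row with
  \<open>cross3 u (cross3 u v)\<close>, and Lagrange's formula turns the latter into
  \<open>- v\<close>. This is the source of the minus sign in the area density.\<close>

lemma det_adapted_frame:
  fixes u v :: "real^3"
  assumes "u \<bullet> u = 1" "v \<bullet> v = 1" "u \<bullet> v = 0"
  shows "det (vector [a *\<^sub>R u + b *\<^sub>R v + c *\<^sub>R cross3 u v, u, cross3 u v] :: real^3^3) = - b"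
proof -
  have "det (vector [a *\<^sub>R u + b *\<^sub>R v + c *\<^sub>R cross3 u v, u, cross3 u v] :: real^3^3)
      = (a *\<^sub>R u + b *\<^sub>R v + c *\<^sub>R cross3 u v) \<bullet> cross3 u (cross3 u v)"
    by (simp add: dot_cross_det)
  also have "cross3 u (cross3 u v) = - v"
    using assms by (simp add: Lagrange)
  finally show ?thesis using assms by (simp add: inner_add_left dot_cross_self)
qed

section \<open>Comparison of the two vanishing orders at the singular point\<close>

theorem corollary3p13:
  fixes I :: "real set" and \<gamma> \<xi> \<xi>t :: "real \<Rightarrow> real^3"
    and p q r qt :: "real \<Rightarrow> real" and k Q :: nat
  assumes I: "open I" "is_interval I" "0 \<in> I"
    and \<gamma>: "\<gamma> real_analytic_on I" "\<gamma> 0 = 0"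
    and \<xi>: "\<xi> real_analytic_on I" "\<forall>x\<in>I. norm (\<xi> x) = 1"
    and pseudo: "pseudo_cylindrical k I \<xi> \<xi>t"
    and pqr: "\<forall>x\<in>I. vector_derivative \<gamma> (at x) =
                p x *\<^sub>R \<xi> x + q x *\<^sub>R xi_d \<xi>t x + r x *\<^sub>R cross3 (\<xi> x) (xi_d \<xi>t x)"
    and developable: "developable_on (ruled_surface \<gamma> \<xi>) (I \<times> UNIV)"
    and q: "qt real_analytic_on I" "\<forall>x\<in>I. q x = qt x * x ^ Q" "k \<le> Q"
  defines "\<Lambda> \<equiv> signed_area_density \<gamma> \<xi> \<xi>t"
    and "\<eta> \<equiv> null_field p"
    and "p\<^sub>0 \<equiv> (0, singular_param \<xi>t qt Q k 0)"
    and "\<sigma> \<equiv> sigma_fun \<xi> \<xi>t p qt Q k"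
  shows "\<forall>n\<ge>1.
      (\<eta> \<Lambda> p\<^sub>0 \<noteq> 0 \<longleftrightarrow> \<sigma> 0 \<noteq> 0) \<and>
      ((\<forall>i\<in>{1..n}. (\<eta> ^^ i) \<Lambda> p\<^sub>0 = 0) \<and> (\<eta> ^^ (n + 1)) \<Lambda> p\<^sub>0 \<noteq> 0
        \<longleftrightarrow> (\<forall>i<n. (deriv ^^ i) \<sigma> 0 = 0) \<and> (deriv ^^ n) \<sigma> 0 \<noteq> 0)"
proof -
  note gs = real_analytic_on_imp_smooth_on_nth[OF \<gamma>(1)]
  note xs = real_analytic_on_imp_smooth_on_nth[OF \<xi>(1)]
  have ts: "smooth_on I (\<lambda>x. \<xi>t x $ i)" for i
    using pseudo by (auto simp: pseudo_cylindrical_def intro: real_analytic_on_imp_smooth_on_nth)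
  have der: "\<forall>x\<in>I. vector_derivative \<xi> (at x) = x ^ k *\<^sub>R \<xi>t x" and nz: "\<And>x. x \<in> I \<Longrightarrow> \<xi>t x \<noteq> 0"
    using pseudo by (auto simp: pseudo_cylindrical_def)
  have orth: "\<xi> x \<bullet> \<xi>t x = 0" if "x \<in> I" for x
    using unit_curve_orthogonal_derivative_factor[OF I(1) xs \<xi>(2) ts der that] .
  have frame: "\<xi> x \<bullet> \<xi> x = 1" "xi_d \<xi>t x \<bullet> xi_d \<xi>t x = 1" "\<xi> x \<bullet> xi_d \<xi>t x = 0" if "x \<in> I" for x
    using that \<xi>(2) nz orth by (simp_all add: xi_d_def norm_eq_1[symmetric] dot_square_norm power2_eq_square)
  have delta: "delta \<xi> \<xi>t x = x ^ k * norm (\<xi>t x)" if "x \<in> I" for x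
    using der that nz by (simp add: delta_def xi_d_def dot_square_norm power2_eq_square)
  have norm_smooth: "smooth_on I (\<lambda>x. norm (\<xi>t x))"
    by (intro smooth_on_norm ts nz)
  have d: "smooth_on I (delta \<xi> \<xi>t)"
    by (rule smooth_on_cong[OF I(1) delta[symmetric]], assumption)
      (intro smooth_on_mult smooth_on_power smooth_on_ident norm_smooth)
  have d\<gamma>: "vector_derivative \<gamma> (at x) = (\<chi> i. deriv (\<lambda>x. \<gamma> x $ i) x)"
    and \<gamma>v: "(\<gamma> has_vector_derivative vector_derivative \<gamma> (at x)) (at x)"
    and \<xi>v: "(\<xi> has_vector_derivative vector_derivative \<xi> (at x)) (at x)" if "x \<in> I" for x
    using smooth_on_nth_has_vector_derivative[OF gs that] smooth_on_nth_has_vector_derivative[OF xs that]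
    by (auto simp: vector_derivative_at)
  \<comment> \<open>No regularity of \<open>p\<close> is assumed; it is recovered as the inner
    product of the derivative of \<open>\<gamma>\<close> with \<open>\<xi>\<close>, by
    orthonormality of the frame.\<close>
  have p: "smooth_on I p"
  proof (rule smooth_on_cong[OF I(1)])
    show "smooth_on I (\<lambda>x. (\<chi> i. deriv (\<lambda>x. \<gamma> x $ i) x) \<bullet> \<xi> x)"
      by (intro smooth_on_inner xs) (simp add: smooth_on_deriv[OF I(1) gs])
    show "(\<chi> i. deriv (\<lambda>x. \<gamma> x $ i) x) \<bullet> \<xi> x = p x" if "x \<in> I" for x
      unfolding d\<gamma>[OF that, symmetric] bspec[OF pqr that] inner_commute[of _ "\<xi> x"]
      using frame[OF that] by (simp add: inner_add_right dot_cross_self)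
  qed
  define \<tau> where "\<tau> = singular_param \<xi>t qt Q k"
  have \<tau>: "smooth_on I \<tau>"
    unfolding \<tau>_def singular_param_def
    by (intro smooth_on_mult smooth_on_uminus smooth_on_divide smooth_on_power smooth_on_ident
        norm_smooth real_analytic_on_imp_smooth_on q) (simp add: nz)
  \<comment> \<open>Here \<open>k \<le> Q\<close> enters, through the splitting of
    \<open>x ^ Q\<close> into \<open>x ^ k * x ^ (Q - k)\<close>. No division by
    \<open>delta\<close> occurs, so the identity also holds at 0.\<close>
  have q\<tau>: "q x = - delta \<xi> \<xi>t x * \<tau> x" if "x \<in> I" for x
    using that q nz by (simp add: delta \<tau>_def singular_param_def flip: power_add)
  have \<Lambda>: "\<Lambda> (x, t) = delta \<xi> \<xi>t x * (\<tau> x - t)" if "x \<in> I" for x t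
  proof -
    have d\<xi>: "vector_derivative \<xi> (at x) = delta \<xi> \<xi>t x *\<^sub>R xi_d \<xi>t x"
      using der that nz by (simp add: delta xi_d_def)
    have "((\<lambda>s. \<gamma> s + t *\<^sub>R \<xi> s) has_vector_derivative
        vector_derivative \<gamma> (at x) + t *\<^sub>R vector_derivative \<xi> (at x)) (at x)"
      by (auto intro!: derivative_eq_intros \<gamma>v \<xi>v that)
    then have "partial_x (ruled_surface \<gamma> \<xi>) (x, t)
        = p x *\<^sub>R \<xi> x + (q x + t * delta \<xi> \<xi>t x) *\<^sub>R xi_d \<xi>t x + r x *\<^sub>R cross3 (\<xi> x) (xi_d \<xi>t x)"
      using that pqr
      by (simp add: partial_x_def ruled_surface_def vector_derivative_at d\<xi> scaleR_add_left)
    moreover have "((\<lambda>s. \<gamma> x + s *\<^sub>R \<xi> x) has_vector_derivative \<xi> x) (at t)"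
      by (auto intro!: derivative_eq_intros)
    then have "partial_t (ruled_surface \<gamma> \<xi>) (x, t) = \<xi> x"
      by (simp add: partial_t_def ruled_surface_def vector_derivative_at)
    ultimately show ?thesis
      unfolding \<Lambda>_def signed_area_density_def unit_normal_def fst_conv
      by (simp only: det_adapted_frame[OF frame[OF that]] q\<tau>[OF that]) (simp add: algebra_simps)
  qed
  define s where "s = (\<lambda>x. p x + deriv \<tau> x)"
  have s: "smooth_on I s" unfolding s_def by (intro smooth_on_add p smooth_on_deriv I \<tau>)
  define a where "a = (\<lambda>j. (deriv ^^ j) (delta \<xi> \<xi>t) 0)"
  define b where "b = (\<lambda>j. (deriv ^^ j) s 0)"
  \<comment> \<open>\<open>delta\<close> is \<open>x ^ k\<close> times a smooth function that is
    nonzero at 0, so its vanishing order there is exactly \<open>k\<close>.\<close>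
  have a: "a i = 0" if "i < k" for i
    unfolding a_def by (rule funpow_deriv_power_mult_0(1)[OF I(1,3) norm_smooth delta that])
  have ak: "a k \<noteq> 0"
    using funpow_deriv_power_mult_0(2)[OF I(1,3) norm_smooth delta] nz[OF I(3)]
    by (simp add: a_def)
  have \<sigma>n: "(deriv ^^ n) \<sigma> 0 = leibniz_sum n a b" for n
    unfolding a_def b_def
    by (rule funpow_deriv_mult[OF I(1) d s _ I(3)]) (simp add: \<sigma>_def sigma_fun_def s_def \<tau>_def)
  \<comment> \<open>Taking \<open>t = \<tau> 0\<close> makes entry 0 of the sequence vanish.\<close>
  have \<eta>n: "(\<eta> ^^ n) \<Lambda> p\<^sub>0 = leibniz_sum n a (case_nat 0 b)" for n
    using funpow_null_field_eq[OF I(1) d \<tau> p \<Lambda> I(3), of n "\<tau> 0"]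
    unfolding a_def b_def s_def \<eta>_def p\<^sub>0_def \<tau>_def by simp
  \<comment> \<open>The leading zero accounts for the offset by one between the iterates of
    \<open>\<eta>\<close> and the derivatives of \<open>\<sigma>\<close>.\<close>
  have shift: "(\<forall>j. j + k < Suc N \<longrightarrow> case_nat 0 b j = 0) \<longleftrightarrow> (\<forall>j. j + k < N \<longrightarrow> b j = 0)" for N
    by (auto split: nat.splits)
  have \<eta>_iff: "(\<forall>i<Suc N. (\<eta> ^^ i) \<Lambda> p\<^sub>0 = 0) \<longleftrightarrow> (\<forall>i<N. (deriv ^^ i) \<sigma> 0 = 0)" for N
    by (simp only: \<eta>n \<sigma>n leibniz_sum_initial_zeros_iff[where a = a and k = k, OF a ak] shift)
  have \<eta>0: "(\<eta> ^^ 0) \<Lambda> p\<^sub>0 = 0"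
    unfolding \<eta>n by simp
  have "\<eta> \<Lambda> p\<^sub>0 \<noteq> 0 \<longleftrightarrow> \<sigma> 0 \<noteq> 0"
    using \<eta>_iff[of 1] \<eta>0 by (simp add: less_Suc_eq)
  moreover have "(\<forall>i\<in>{1..n}. (\<eta> ^^ i) \<Lambda> p\<^sub>0 = 0) \<and> (\<eta> ^^ (n + 1)) \<Lambda> p\<^sub>0 \<noteq> 0
        \<longleftrightarrow> (\<forall>i<n. (deriv ^^ i) \<sigma> 0 = 0) \<and> (deriv ^^ n) \<sigma> 0 \<noteq> 0" for n
  proof -
    \<comment> \<open>The index 0 may be added, since the area density itself vanishes at the
      singular point. The exact-order claim then follows by comparing \<open>\<eta>_iff\<close> at
      \<open>n\<close> and at \<open>Suc n\<close>.\<close>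
    have "(\<forall>i\<in>{1..n}. (\<eta> ^^ i) \<Lambda> p\<^sub>0 = 0) \<longleftrightarrow> (\<forall>i<Suc n. (\<eta> ^^ i) \<Lambda> p\<^sub>0 = 0)"
      using \<eta>0 by (metis atLeastAtMost_iff less_Suc_eq_le less_one linorder_not_le)
    moreover have "(\<forall>i<Suc (Suc n). (\<eta> ^^ i) \<Lambda> p\<^sub>0 = 0)
        \<longleftrightarrow> (\<forall>i<Suc n. (\<eta> ^^ i) \<Lambda> p\<^sub>0 = 0) \<and> (\<eta> ^^ (n + 1)) \<Lambda> p\<^sub>0 = 0"
      by (simp only: Suc_eq_plus1[symmetric]) (metis less_Suc_eq)
    moreover have "(\<forall>i<Suc n. (deriv ^^ i) \<sigma> 0 = 0)
        \<longleftrightarrow> (\<forall>i<n. (deriv ^^ i) \<sigma> 0 = 0) \<and> (deriv ^^ n) \<sigma> 0 = 0"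
      by (metis less_Suc_eq)
    ultimately show ?thesis
      using \<eta>_iff[of n] \<eta>_iff[of "Suc n"] by blast
  qed
  ultimately show ?thesis by blast
qed

end
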